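(* Let $X,Y$ be real Hilbert spaces, let $G\colon X\to Y'$ be a boundedly invertible linear operator, let $f\in Y'$, and let $u\in X$ be the solution of $Gu=f$. For $\delta$ in an index set, let $\{0\}\subsetneq X^\delta\subsetneq X$ and $\{0\}\subsetneq Y^\delta\subsetneq Y$ be closed subspaces, and let $\{0\}\subsetneq\hat X^\delta\subsetneq X$ be a finite dimensional subspace, such that $$\gamma^\delta:=\inf_{0\neq w\in X^\delta}\frac{\sup_{0\neq y\in Y^\delta}\frac{|(Gw)(y)|}{\|G'y\|_{X'}}}{\|w\|_X}>0,\qquad \mu^\delta:=\inf_{0\neq v\in Y^\delta}\frac{\sup_{0\neq w\in\hat X^\delta}\frac{|(G'v)(w)|}{\|w\|_X}}{\|G'v\|_{X'}}>0 .$$ For each $\delta$, let $\Pi^\delta\colon Y\to Y^\delta$ be a Fortin interpolator, i.e. a bounded linear operator with $$(Gw)\big((\mathrm{Id}-\Pi^\delta)v\big)=0\qquad\text{for all }w\in X^\delta,\ v\in Y,$$ such that $c/\gamma^\delta\le\|G'\Pi^\delta{G'}^{-1}\|_{\mathcal L(X',X')}\le C/\gamma^\delta$ for some constants $0<c\le C<\infty$ independent of $\delta$. Let $(\theta^\delta,\lambda^\delta,u^\delta)\in\hat X^\delta\times Y^\delta\times X^\delta$ be the solution of $$\left\{\begin{array}{rcll} \langle\theta^\delta,\tilde\theta^\delta\rangle_X-(G\tilde\theta^\delta)(\lambda^\delta)&=&0&\text{for all }\tilde\theta^\delta\in\hat X^\delta,\\ -(G\theta^\delta)(\tilde\lambda^\delta)-(Gu^\delta)(\tilde\lambda^\delta)&=&-f(\tilde\lambda^\delta)&\text{for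 all }\tilde\lambda^\delta\in Y^\delta,\\ -(G\tilde u^\delta)(\lambda^\delta)&=&0&\text{for all }\tilde u^\delta\in X^\delta, \end{array}\right.$$ and set $\mathrm{osc}^\delta(f):=\|G^{-1}(\mathrm{Id}-\Pi^\delta)'f\|_X$. Then, for each $\delta$, $$\mu^\delta\|\theta^\delta\|_X\le\|u-u^\delta\|_X\le\|G'\Pi^\delta{G'}^{-1}\|_{\mathcal L(X',X')}\,\|\theta^\delta\|_X+\mathrm{osc}^\delta(f).$$
   Context: For a Hilbert space $Z$, $Z'$ denotes its (topological) dual, equipped with the dual norm. The operator $G'\colon Y\to X'$ is the adjoint of $G$, i.e. $(G'v)(w)=(Gw)(v)$ for $v\in Y$, $w\in X$; it is boundedly invertible, with inverse ${G'}^{-1}\colon X'\to Y$. $\|\cdot\|_{\mathcal L(X',X')}$ is the operator norm of bounded linear operators on $X'$; in $G'\Pi^\delta{G'}^{-1}$ the range space $Y^\delta$ of $\Pi^\delta$ is viewed as a subspace of $Y$. The adjoint $(\mathrm{Id}-\Pi^\delta)'\colon Y'\to Y'$ is given by $((\mathrm{Id}-\Pi^\delta)'f)(v)=f((\mathrm{Id}-\Pi^\delta)v)$ for $v\in Y$. The space $\hat X^\delta$ is equipped with the scalar product and norm of $X$. The superscript $\delta$ is just an index (for "discrete") labelling the chosen subspaces. *)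

theory Defs
  imports "HOL-Analysis.Analysis"
begin

definition boundedly_invertible ::
    "('a::real_normed_vector \<Rightarrow>\<^sub>L 'b::real_normed_vector) \<Rightarrow> bool" where
  "boundedly_invertible T \<longleftrightarrow>
     bij (blinfun_apply T) \<and> bounded_linear (inv (blinfun_apply T))"

text \<open>The topological dual of a space of type \<open>'a\<close> is \<open>'a \<Rightarrow>\<^sub>L real\<close>; its norm is the dual norm.
  For \<open>G\<close> from \<open>X\<close> into the dual of \<open>Y\<close>, the adjoint is taken as a map from \<open>Y\<close> (identified with
  its bidual) into the dual of \<open>X\<close>. Both uses of \<open>Blinfun\<close> are applied to bounded linear maps,
  see \<open>adj_apply\<close> below.\<close>

definition adj ::
    "('x::real_normed_vector \<Rightarrow>\<^sub>L ('y::real_normed_vector \<Rightarrow>\<^sub>L real)) \<Rightarrow> ('y \<Rightarrow>\<^sub>L ('x \<Rightarrow>\<^sub>L real))" where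
  "adj G = Blinfun (\<lambda>v. Blinfun (\<lambda>w. blinfun_apply (blinfun_apply G w) v))"

lemma adj_apply: "blinfun_apply (blinfun_apply (adj G) v) w = blinfun_apply (blinfun_apply G w) v"
proof -
  interpret b: bounded_bilinear "\<lambda>v w. blinfun_apply (blinfun_apply G w) v"
    by (rule bounded_bilinear.flip)
       (rule bounded_bilinear.comp1[OF bounded_bilinear_blinfun_apply blinfun.bounded_linear_right])
  have "bounded_linear (\<lambda>v. b.prod_right v)"
    by (rule b.bounded_linear_prod_right)
  then have "bounded_linear (\<lambda>v. Blinfun (\<lambda>w. blinfun_apply (blinfun_apply G w) v))"
    by (simp add: b.prod_right_def)
  then show ?thesis
    by (simp add: adj_def bounded_linear_Blinfun_apply b.bounded_linear_right)
qed

definition dual_map ::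
    "('a::real_normed_vector \<Rightarrow>\<^sub>L 'b::real_normed_vector) \<Rightarrow> ('b \<Rightarrow>\<^sub>L real) \<Rightarrow> ('a \<Rightarrow>\<^sub>L real)" where
  "dual_map T f = f o\<^sub>L T"

definition finite_dim_subspace :: "'a::real_vector set \<Rightarrow> bool" where
  "finite_dim_subspace V \<longleftrightarrow> (\<exists>B. finite B \<and> V = span B)"

text \<open>The suprema and infima below are over nonempty bounded sets of reals whenever \<open>G\<close> is boundedly
  invertible and the subspaces are nontrivial: the inner quotients are at most \<open>norm w\<close> and
  \<open>norm (adj G v)\<close>, respectively.\<close>

definition gamma_const ::
    "('x::real_normed_vector \<Rightarrow>\<^sub>L ('y::real_normed_vector \<Rightarrow>\<^sub>L real)) \<Rightarrow> 'x set \<Rightarrow> 'y set \<Rightarrow> real" where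
  "gamma_const G Xd Yd =
     (INF w\<in>Xd - {0}. (SUP y\<in>Yd - {0}. \<bar>blinfun_apply (blinfun_apply G w) y\<bar> / norm (blinfun_apply (adj G) y)) / norm w)"

definition mu_const ::
    "('x::real_normed_vector \<Rightarrow>\<^sub>L ('y::real_normed_vector \<Rightarrow>\<^sub>L real)) \<Rightarrow> 'x set \<Rightarrow> 'y set \<Rightarrow> real" where
  "mu_const G Xhat Yd =
     (INF v\<in>Yd - {0}. (SUP w\<in>Xhat - {0}. \<bar>blinfun_apply (blinfun_apply (adj G) v) w\<bar> / norm w) / norm (blinfun_apply (adj G) v))"

text \<open>A Fortin interpolator is not required to be a projection.\<close>

definition fortin_interpolator ::
    "('x::real_normed_vector \<Rightarrow>\<^sub>L ('y::real_normed_vector \<Rightarrow>\<^sub>L real)) \<Rightarrow> 'x set \<Rightarrow> 'y set \<Rightarrow> ('y \<Rightarrow>\<^sub>L 'y) \<Rightarrow> bool" where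
  "fortin_interpolator G Xd Yd P \<longleftrightarrow>
     range (blinfun_apply P) \<subseteq> Yd \<and>
     (\<forall>w\<in>Xd. \<forall>v. blinfun_apply (blinfun_apply G w) (blinfun_apply (id_blinfun - P) v) = 0)"

definition fortin_norm ::
    "('x::real_normed_vector \<Rightarrow>\<^sub>L ('y::real_normed_vector \<Rightarrow>\<^sub>L real)) \<Rightarrow> ('y \<Rightarrow>\<^sub>L 'y) \<Rightarrow> real" where
  "fortin_norm G P =
     onorm (blinfun_apply (adj G) \<circ> blinfun_apply P \<circ> inv (blinfun_apply (adj G)))"

definition osc ::
    "('x::real_normed_vector \<Rightarrow>\<^sub>L ('y::real_normed_vector \<Rightarrow>\<^sub>L real)) \<Rightarrow> ('y \<Rightarrow>\<^sub>L 'y) \<Rightarrow> ('y \<Rightarrow>\<^sub>L real) \<Rightarrow> real" where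
  "osc G P f = norm (inv (blinfun_apply G) (dual_map (id_blinfun - P) f))"

definition saddle_solution ::
    "('x::real_inner \<Rightarrow>\<^sub>L ('y::real_normed_vector \<Rightarrow>\<^sub>L real)) \<Rightarrow> ('y \<Rightarrow>\<^sub>L real) \<Rightarrow>
     'x set \<Rightarrow> 'y set \<Rightarrow> 'x set \<Rightarrow> 'x \<Rightarrow> 'y \<Rightarrow> 'x \<Rightarrow> bool" where
  "saddle_solution G f Xhat Yd Xd \<theta> l ud \<longleftrightarrow>
     \<theta> \<in> Xhat \<and> l \<in> Yd \<and> ud \<in> Xd \<and>
     (\<forall>\<theta>'\<in>Xhat. inner \<theta> \<theta>' - blinfun_apply (blinfun_apply G \<theta>') l = 0) \<and>
     (\<forall>l'\<in>Yd. - blinfun_apply (blinfun_apply G \<theta>) l' - blinfun_apply (blinfun_apply G ud) l' = - blinfun_apply f l') \<and>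
     (\<forall>u'\<in>Xd. - blinfun_apply (blinfun_apply G u') l = 0)"

end

theory Submission
  imports Defs
begin

text \<open>Test the error \<open>u - ud\<close> against functionals \<open>adj G v\<close>. On \<open>Y\<^sup>\<delta>\<close> the second equation of the
  saddle point system replaces \<open>u - ud\<close> by \<open>\<theta>\<close>. Taking \<open>v = \<lambda>\<close> gives \<open>\<parallel>\<theta>\<parallel>\<^sup>2\<close>, while the first equation
  and the definition of \<open>\<mu>\<close> bound the norm of \<open>adj G \<lambda>\<close> by \<open>\<parallel>\<theta>\<parallel> / \<mu>\<close>: this is the lower bound.
  For the upper bound, \<open>v\<close> is chosen such that \<open>adj G v\<close> is the inner product with the error, and
  \<open>v\<close> is split into \<open>\<Pi> v\<close>, treated as before, and \<open>(Id - \<Pi>) v\<close>, on which \<open>G ud\<close> vanishes,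
  so that only the oscillation of \<open>f\<close> remains. Surjectivity of \<open>adj G\<close> is the reflexivity of
  the Hilbert space \<open>Y\<close>, which follows from Riesz' theorem.\<close>

section \<open>Riesz representation and reflexivity of Hilbert spaces\<close>

text \<open>The representative is the minimiser of \<open>\<parallel>y\<parallel>\<^sup>2 - 2 f y\<close>; by the parallelogram law every
  minimising sequence is Cauchy.\<close>

theorem riesz_representation:
  fixes f :: "'a::{real_inner,complete_space} \<Rightarrow>\<^sub>L real"
  obtains y where "\<And>z. blinfun_apply f z = inner y z"
proof -
  define J where "J y = (norm y)\<^sup>2 - 2 * blinfun_apply f y" for y
  define m where "m = (INF y. J y)"
  have lower: "- (norm f)\<^sup>2 \<le> J y" for y
  proof -
    have "blinfun_apply f y \<le> norm f * norm y"
      using norm_blinfun[of f y] by simp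
    moreover have "0 \<le> (norm y - norm f)\<^sup>2"
      by simp
    ultimately show ?thesis
      unfolding J_def power2_diff by (simp add: algebra_simps)
  qed
  have bdd: "bdd_below (range J)"
    by (rule bdd_belowI2[OF lower])
  have m_le: "m \<le> J y" for y
    unfolding m_def by (rule cINF_lower[OF bdd]) simp
  have "\<exists>y. J y < m + inverse (real (Suc n))" for n
    using cInf_lessD[of "range J" "m + inverse (real (Suc n))"] by (auto simp: m_def)
  then obtain s where s: "\<And>n. J (s n) < m + inverse (real (Suc n))"
    by metis
  \<comment> \<open>Parallelogram law for \<open>a\<close> and \<open>b\<close>, in which the linear
    parts of \<open>J\<close> cancel; the midpoint has value at least \<open>m\<close>.\<close>
  have mid: "(norm (a - b))\<^sup>2 \<le> 2 * J a + 2 * J b - 4 * m" for a b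
  proof -
    have "(norm (a - b))\<^sup>2 = 2 * J a + 2 * J b - 4 * J ((1/2) *\<^sub>R (a + b))"
      unfolding J_def power2_norm_eq_inner
      by (simp add: inner_simps blinfun.bilinear_simps inner_commute algebra_simps)
    then show ?thesis
      using m_le[of "(1/2) *\<^sub>R (a + b)"] by simp
  qed
  have "Cauchy s"
  proof (rule metric_CauchyI)
    fix e :: real assume "0 < e"
    \<comment> \<open>By \<open>mid\<close>, two points whose values of \<open>J\<close> exceed
      \<open>m\<close> by less than \<open>q\<close> have squared distance less than
      \<open>4 * q\<close>.\<close>
    define q where "q = e\<^sup>2 / 4"
    have "0 < q"
      using \<open>0 < e\<close> by (simp add: q_def)
    then obtain N where N: "inverse (real (Suc N)) < q"
      using reals_Archimedean by blast
    have "dist (s i) (s j) < e" if "N \<le> i" "N \<le> j" for i j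
    proof -
      have near: "J (s k) < m + q" if "N \<le> k" for k
      proof -
        have "inverse (real (Suc k)) \<le> inverse (real (Suc N))"
          using that by (intro le_imp_inverse_le) auto
        then show ?thesis
          using s[of k] N by linarith
      qed
      have "(norm (s i - s j))\<^sup>2 < 4 * q"
        using mid[of "s i" "s j"] near[OF that(1)] near[OF that(2)] by linarith
      then have "(norm (s i - s j))\<^sup>2 < e\<^sup>2"
        by (simp add: q_def)
      then show ?thesis
        using \<open>0 < e\<close> by (simp add: dist_norm power_less_imp_less_base)
    qed
    then show "\<exists>M. \<forall>i\<ge>M. \<forall>j\<ge>M. dist (s i) (s j) < e"
      by blast
  qed
  then obtain y where y: "s \<longlonglongrightarrow> y"
    using Cauchy_convergent convergent_def by blast
  have "(\<lambda>n. J (s n)) \<longlonglongrightarrow> J y"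
    unfolding J_def by (intro tendsto_intros y)
  moreover have "(\<lambda>n. m + inverse (real (Suc n))) \<longlonglongrightarrow> m + 0"
    by (intro tendsto_intros LIMSEQ_inverse_real_of_nat)
  ultimately have min: "J y \<le> m"
    using s by (intro LIMSEQ_le[of "\<lambda>n. J (s n)" _ "\<lambda>n. m + inverse (real (Suc n))"])
      (auto intro!: exI[of _ 0] less_imp_le)
  show thesis
  proof
    fix z
    define a where "a = blinfun_apply f z - inner y z"
    \<comment> \<open>Minimality of \<open>y\<close> along the line through \<open>y\<close> in
      direction \<open>z\<close>.\<close>
    have quad: "2 * t * a \<le> t\<^sup>2 * (norm z)\<^sup>2" for t
    proof -
      have "J (y + t *\<^sub>R z) = J y - 2 * t * a + t\<^sup>2 * (norm z)\<^sup>2"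
        unfolding J_def a_def power2_norm_eq_inner
        by (simp add: inner_simps blinfun.bilinear_simps inner_commute algebra_simps power2_eq_square)
      then show ?thesis
        using m_le[of "y + t *\<^sub>R z"] min by linarith
    qed
    \<comment> \<open>The quadratic in \<open>t\<close> would be optimised at \<open>a\<close> over
      the squared norm of \<open>z\<close>; the added 1 keeps the quotient meaningful for
      \<open>z = 0\<close> and still forces \<open>a = 0\<close>.\<close>
    define d where "d = 1 + (norm z)\<^sup>2"
    have d: "0 < d" "(norm z)\<^sup>2 \<le> d"
      unfolding d_def by (simp_all add: add_pos_nonneg)
    have "2 * (a / d) * a \<le> (a / d)\<^sup>2 * d"
      using quad[of "a / d"] mult_left_mono[OF d(2), of "(a / d)\<^sup>2"] by simp
    also have "\<dots> = (a / d) * a"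
      using d by (simp add: power2_eq_square)
    finally have "a * a / d \<le> 0"
      by simp
    then have "a = 0"
      using d by (auto simp: divide_le_0_iff mult_le_0_iff)
    then show "blinfun_apply f z = inner y z"
      by (simp add: a_def)
  qed
qed

text \<open>Cauchy-Schwarz gives one inequality, evaluation at \<open>y\<close> itself the
  other.\<close>

lemma norm_blinfun_inner_right [simp]: "norm (blinfun_inner_right y) = norm y"
proof (rule antisym)
  show "norm (blinfun_inner_right y) \<le> norm y"
    by (rule norm_blinfun_bound) (auto simp: Cauchy_Schwarz_ineq2)
  have "norm y * norm y \<le> norm (blinfun_inner_right y) * norm y"
    using norm_blinfun[of "blinfun_inner_right y" y]
    by (simp add: power2_norm_eq_inner[symmetric] power2_eq_square)
  then show "norm y \<le> norm (blinfun_inner_right y)"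
    by (cases "y = 0") auto
qed

text \<open>Riesz is used twice: for \<open>\<phi>\<close> pulled back to the space along the Riesz
  map, which yields \<open>v\<close>, and for \<open>h\<close>, which puts every functional in the
  image of that map.\<close>

lemma hilbert_reflexive:
  fixes \<phi> :: "('a::{real_inner,complete_space} \<Rightarrow>\<^sub>L real) \<Rightarrow>\<^sub>L real"
  obtains v where "\<And>h. blinfun_apply \<phi> h = blinfun_apply h v"
proof -
  have bl: "bounded_linear (\<lambda>y::'a. blinfun_apply \<phi> (blinfun_inner_right y))"
    by (rule bounded_linear_compose[OF blinfun.bounded_linear_right bounded_linear_blinfun_inner_right])
  obtain v where "\<And>y. blinfun_apply (Blinfun (\<lambda>y. blinfun_apply \<phi> (blinfun_inner_right y))) y = inner v y"
    using riesz_representation by blast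
  then have v: "blinfun_apply \<phi> (blinfun_inner_right y) = inner v y" for y
    by (simp add: bounded_linear_Blinfun_apply[OF bl])
  show thesis
  proof
    fix h :: "'a \<Rightarrow>\<^sub>L real"
    obtain y where y: "\<And>z. blinfun_apply h z = inner y z"
      using riesz_representation by blast
    then have "h = blinfun_inner_right y"
      by (intro blinfun_eqI) simp
    then show "blinfun_apply \<phi> h = blinfun_apply h v"
      using v[of y] by (simp add: inner_commute)
  qed
qed

section \<open>Bounded invertibility of the adjoint\<close>

lemma boundedly_invertible_adj:
  fixes G :: "'x::real_normed_vector \<Rightarrow>\<^sub>L ('y::{real_inner,complete_space} \<Rightarrow>\<^sub>L real)"
  assumes "boundedly_invertible G"
  shows "boundedly_invertible (adj G)"
proof -
  from assms have bij: "bij (blinfun_apply G)" and bl: "bounded_linear (inv (blinfun_apply G))"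
    by (auto simp: boundedly_invertible_def)
  have G_inv: "blinfun_apply G (inv (blinfun_apply G) h) = h" for h
    using bij by (simp add: bij_is_surj surj_f_inv_f)
  obtain K where K: "0 < K" "\<And>h. norm (inv (blinfun_apply G) h) \<le> norm h * K"
    using bounded_linear.pos_bounded[OF bl] by blast
  have bound: "norm v \<le> norm (blinfun_apply (adj G) v) * K" for v
  proof -
    \<comment> \<open>\<open>G w\<close> is the inner product with \<open>v\<close>, so
      \<open>adj G v\<close> takes the value of the squared norm of \<open>v\<close> at
      \<open>w\<close>. The inverse of \<open>adj G\<close> thus inherits the bound \<open>K\<close>
      from that of \<open>G\<close>.\<close>
    define w where "w = inv (blinfun_apply G) (blinfun_inner_right v)"
    have "norm v * norm v = blinfun_apply (blinfun_apply (adj G) v) w"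
      by (simp add: adj_apply w_def G_inv power2_norm_eq_inner[symmetric] power2_eq_square)
    also have "\<dots> \<le> norm (blinfun_apply (adj G) v) * norm w"
      using norm_blinfun[of "blinfun_apply (adj G) v" w] by simp
    also have "\<dots> \<le> norm (blinfun_apply (adj G) v) * (norm v * K)"
      using K(2)[of "blinfun_inner_right v"] by (intro mult_left_mono) (auto simp: w_def)
    finally have "norm v * norm v \<le> (norm (blinfun_apply (adj G) v) * K) * norm v"
      by (simp add: ac_simps)
    then show ?thesis
      using K(1) by (cases "v = 0") auto
  qed
  have inj: "inj (blinfun_apply (adj G))"
  proof (subst linear_injective_0)
    show "linear (blinfun_apply (adj G))"
      by (intro bounded_linear.linear blinfun.bounded_linear_right)
    show "\<forall>v. blinfun_apply (adj G) v = 0 \<longrightarrow> v = 0"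
    proof (intro allI impI)
      fix v assume "blinfun_apply (adj G) v = 0"
      then show "v = 0"
        using bound[of v] by simp
    qed
  qed
  have surj: "surj (blinfun_apply (adj G))"
  proof (rule surjI)
    fix g :: "'x \<Rightarrow>\<^sub>L real"
    \<comment> \<open>\<open>g\<close> composed with the inverse of \<open>G\<close> is a functional
      on the dual of \<open>Y\<close>; its representing vector is the preimage of
      \<open>g\<close>.\<close>
    obtain v where v: "\<And>h. blinfun_apply (g o\<^sub>L Blinfun (inv (blinfun_apply G))) h = blinfun_apply h v"
      using hilbert_reflexive by blast
    have "blinfun_apply (adj G) v = g"
    proof (rule blinfun_eqI)
      fix w
      have "blinfun_apply (blinfun_apply G w) v = blinfun_apply g (inv (blinfun_apply G) (blinfun_apply G w))"
        using v[of "blinfun_apply G w"] by (simp add: bounded_linear_Blinfun_apply[OF bl])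
      then show "blinfun_apply (blinfun_apply (adj G) v) w = blinfun_apply g w"
        using bij by (simp add: adj_apply bij_is_inj)
    qed
    then show "blinfun_apply (adj G) (inv (blinfun_apply (adj G)) g) = g"
      by (metis f_inv_into_f rangeI)
  qed
  have inv_adj: "blinfun_apply (adj G) (inv (blinfun_apply (adj G)) g) = g" for g
    by (rule surj_f_inv_f[OF surj])
  \<comment> \<open>Each identity is checked after applying the injective map
    \<open>adj G\<close>.\<close>
  have "linear (inv (blinfun_apply (adj G)))"
    by (rule linearI; rule injD[OF inj]) (simp_all add: inv_adj blinfun.bilinear_simps)
  moreover have "norm (inv (blinfun_apply (adj G)) g) \<le> norm g * K" for g
    using bound[of "inv (blinfun_apply (adj G)) g"] by (simp add: inv_adj)
  ultimately have "bounded_linear (inv (blinfun_apply (adj G)))"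
    by (auto simp: bounded_linear_def bounded_linear_axioms_def linear_def)
  with inj surj show ?thesis
    by (simp add: boundedly_invertible_def bij_def)
qed

section \<open>The inf-sup constant and the lower bound\<close>

text \<open>If \<open>adj G v = 0\<close>, the quotient defining \<open>mu_const\<close> is a division by zero, but the
  inequality is trivial.\<close>

lemma mu_const_mult_le:
  fixes G :: "'x::real_normed_vector \<Rightarrow>\<^sub>L ('y::real_normed_vector \<Rightarrow>\<^sub>L real)"
  assumes nontrivial: "{0} \<subset> Xhat" and v: "v \<in> Yd" and "0 \<le> b"
    and b: "\<And>w. w \<in> Xhat \<Longrightarrow> \<bar>blinfun_apply (blinfun_apply (adj G) v) w\<bar> \<le> b * norm w"
  shows "mu_const G Xhat Yd * norm (blinfun_apply (adj G) v) \<le> b"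
proof (cases "blinfun_apply (adj G) v = 0")
  case True
  then show ?thesis using \<open>0 \<le> b\<close> by simp
next
  case False
  then have "v \<noteq> 0" by auto
  \<comment> \<open>A nonzero \<open>w0\<close> makes the supremum range over a nonempty set; this
    gives both its sign and its upper bound \<open>b\<close>.\<close>
  from nontrivial obtain w0 where w0: "w0 \<in> Xhat - {0}" by blast
  define S where "S v = (SUP w\<in>Xhat - {0}. \<bar>blinfun_apply (blinfun_apply (adj G) v) w\<bar> / norm w)" for v
  have S_nonneg: "0 \<le> S v" for v
  proof -
    have "bdd_above ((\<lambda>w. \<bar>blinfun_apply (blinfun_apply (adj G) v) w\<bar> / norm w) ` (Xhat - {0}))"
      using norm_blinfun[of "blinfun_apply (adj G) v"]
      by (intro bdd_aboveI2[where M = "norm (blinfun_apply (adj G) v)"]) (simp add: divide_le_eq)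
    then have "\<bar>blinfun_apply (blinfun_apply (adj G) v) w0\<bar> / norm w0 \<le> S v"
      unfolding S_def by (rule cSUP_upper[OF w0])
    then show ?thesis
      by (rule order_trans[rotated]) simp
  qed
  have "bdd_below ((\<lambda>v. S v / norm (blinfun_apply (adj G) v)) ` (Yd - {0}))"
    using S_nonneg by (intro bdd_belowI2[where m = 0]) simp
  then have "mu_const G Xhat Yd \<le> S v / norm (blinfun_apply (adj G) v)"
    unfolding mu_const_def S_def[symmetric] using v \<open>v \<noteq> 0\<close> by (intro cINF_lower) auto
  moreover have "S v \<le> b"
    unfolding S_def using w0 b by (intro cSUP_least) (auto simp: divide_le_eq)
  ultimately show ?thesis
    using False by (simp add: le_divide_eq)
qed

lemma saddle_solution_residual:
  assumes "saddle_solution G (blinfun_apply G u) Xhat Yd Xd \<theta> l ud" and "v \<in> Yd"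
  shows "blinfun_apply (blinfun_apply (adj G) v) (u - ud) = blinfun_apply (blinfun_apply (adj G) v) \<theta>"
  using assms by (auto simp: saddle_solution_def adj_apply blinfun.bilinear_simps algebra_simps)

lemma saddle_lower_bound:
  fixes G :: "'x::real_inner \<Rightarrow>\<^sub>L ('y::real_normed_vector \<Rightarrow>\<^sub>L real)"
  assumes sol: "saddle_solution G (blinfun_apply G u) Xhat Yd Xd \<theta> l ud"
    and "{0} \<subset> Xhat" and "0 \<le> mu_const G Xhat Yd"
  shows "mu_const G Xhat Yd * norm \<theta> \<le> norm (u - ud)"
proof -
  let ?\<mu> = "mu_const G Xhat Yd" and ?g = "blinfun_apply (adj G) l"
  from sol have "l \<in> Yd" "\<theta> \<in> Xhat"
    and eq: "\<And>w. w \<in> Xhat \<Longrightarrow> blinfun_apply ?g w = inner \<theta> w"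
    by (auto simp: saddle_solution_def adj_apply)
  \<comment> \<open>On \<open>Xhat\<close> the functional \<open>?g\<close> is the inner product
    with \<open>\<theta>\<close>, so Cauchy-Schwarz allows \<open>b = norm \<theta>\<close>.\<close>
  have \<mu>: "?\<mu> * norm ?g \<le> norm \<theta>"
    using assms \<open>l \<in> Yd\<close> by (intro mu_const_mult_le) (auto simp: eq Cauchy_Schwarz_ineq2)
  have "norm \<theta> * norm \<theta> = blinfun_apply ?g (u - ud)"
    using saddle_solution_residual[OF sol \<open>l \<in> Yd\<close>] eq[OF \<open>\<theta> \<in> Xhat\<close>]
    by (simp add: power2_norm_eq_inner[symmetric] power2_eq_square)
  also have "\<dots> \<le> norm ?g * norm (u - ud)"
    using norm_blinfun[of ?g "u - ud"] by simp
  finally have "?\<mu> * (norm \<theta> * norm \<theta>) \<le> ?\<mu> * (norm ?g * norm (u - ud))"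
    using assms(3) by (rule mult_left_mono)
  also have "\<dots> \<le> norm \<theta> * norm (u - ud)"
    using mult_right_mono[OF \<mu>, of "norm (u - ud)"] by (simp add: mult.assoc)
  finally have "norm \<theta> * (?\<mu> * norm \<theta>) \<le> norm \<theta> * norm (u - ud)"
    by (simp add: ac_simps)
  then show ?thesis
    by (cases "\<theta> = 0") auto
qed

section \<open>The Fortin interpolator and the upper bound\<close>

text \<open>\<open>fortin_norm\<close> measures \<open>P\<close> in the norm that
  \<open>adj G\<close> induces on \<open>Y\<close>: the inverse inside the operator norm turns
  \<open>adj G v\<close> back into \<open>v\<close>.\<close>

lemma norm_adj_fortin_le:
  assumes "boundedly_invertible (adj G)"
  shows "norm (blinfun_apply (adj G) (blinfun_apply P v)) \<le> fortin_norm G P * norm (blinfun_apply (adj G) v)"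
proof -
  let ?T = "blinfun_apply (adj G) \<circ> blinfun_apply P \<circ> inv (blinfun_apply (adj G))"
  have "bounded_linear (inv (blinfun_apply (adj G)))" and inj: "inj (blinfun_apply (adj G))"
    using assms by (auto simp: boundedly_invertible_def bij_def)
  then have "bounded_linear ?T"
    by (intro bounded_linear_compose[unfolded o_def[symmetric]] blinfun.bounded_linear_right)
  from onorm[OF this, of "blinfun_apply (adj G) v"] show ?thesis
    using inj by (simp add: fortin_norm_def)
qed

lemma saddle_upper_bound:
  fixes G :: "'x::real_inner \<Rightarrow>\<^sub>L ('y::{real_inner,complete_space} \<Rightarrow>\<^sub>L real)"
  assumes inv: "boundedly_invertible G"
    and sol: "saddle_solution G (blinfun_apply G u) Xhat Yd Xd \<theta> l ud"
    and P: "fortin_interpolator G Xd Yd P"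
  shows "norm (u - ud) \<le> fortin_norm G P * norm \<theta> + osc G P (blinfun_apply G u)"
proof -
  define e where "e = u - ud"
  define r where "r = inv (blinfun_apply G) (dual_map (id_blinfun - P) (blinfun_apply G u))"
  have adj: "boundedly_invertible (adj G)"
    using inv by (rule boundedly_invertible_adj)
  then have "surj (blinfun_apply (adj G))"
    by (simp add: boundedly_invertible_def bij_is_surj)
  then obtain v where v: "blinfun_apply (adj G) v = blinfun_inner_right e"
    by (metis surj_def)
  have "ud \<in> Xd"
    using sol by (simp add: saddle_solution_def)
  then have "blinfun_apply (blinfun_apply G ud) (blinfun_apply (id_blinfun - P) v) = 0"
    using P unfolding fortin_interpolator_def by blast
  then have "blinfun_apply (blinfun_apply (adj G) (v - blinfun_apply P v)) e
      = blinfun_apply (dual_map (id_blinfun - P) (blinfun_apply G u)) v"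
    by (simp add: adj_apply e_def dual_map_def blinfun.bilinear_simps)
  \<comment> \<open>\<open>G r\<close> is the oscillation functional, so its value at
    \<open>v\<close> is that of \<open>adj G v\<close> at \<open>r\<close>, namely the inner product
    of \<open>e\<close> and \<open>r\<close>.\<close>
  also have "\<dots> = blinfun_apply (blinfun_apply (adj G) v) r"
    using inv by (simp add: adj_apply r_def boundedly_invertible_def bij_is_surj surj_f_inv_f)
  also have "\<dots> \<le> norm e * norm r"
    by (simp add: v norm_cauchy_schwarz)
  finally have osc: "blinfun_apply (blinfun_apply (adj G) (v - blinfun_apply P v)) e \<le> norm e * norm r" .
  have "blinfun_apply P v \<in> Yd"
    using P by (auto simp: fortin_interpolator_def)
  from saddle_solution_residual[OF sol this]
  have "blinfun_apply (blinfun_apply (adj G) (blinfun_apply P v)) e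
      = blinfun_apply (blinfun_apply (adj G) (blinfun_apply P v)) \<theta>"
    by (simp add: e_def)
  also have "\<dots> \<le> norm (blinfun_apply (adj G) (blinfun_apply P v)) * norm \<theta>"
    using norm_blinfun[of "blinfun_apply (adj G) (blinfun_apply P v)" \<theta>] by simp
  also have "\<dots> \<le> fortin_norm G P * norm e * norm \<theta>"
    using norm_adj_fortin_le[OF adj, of P v] by (intro mult_right_mono) (auto simp: v)
  finally have "blinfun_apply (blinfun_apply (adj G) (blinfun_apply P v)) e \<le> fortin_norm G P * norm e * norm \<theta>" .
  moreover have "norm e * norm e = blinfun_apply (blinfun_apply (adj G) (blinfun_apply P v)) e
      + blinfun_apply (blinfun_apply (adj G) (v - blinfun_apply P v)) e"
    using arg_cong[OF v, of "\<lambda>g. blinfun_apply g e"]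
    by (simp add: blinfun.bilinear_simps power2_norm_eq_inner[symmetric] power2_eq_square)
  ultimately have "norm e * norm e \<le> norm e * (fortin_norm G P * norm \<theta> + norm r)"
    using osc by (simp add: algebra_simps)
  \<comment> \<open>For \<open>e \<noteq> 0\<close> a factor \<open>norm e\<close> cancels; for
    \<open>e = 0\<close> the claim is that the right-hand side is nonnegative.\<close>
  moreover have "0 \<le> fortin_norm G P * norm \<theta> + norm r" if "e = 0"
  proof -
    have "0 \<le> fortin_norm G P"
      unfolding fortin_norm_def
      using adj
      by (intro onorm_pos_le bounded_linear_compose[unfolded o_def[symmetric]] blinfun.bounded_linear_right)
        (simp add: boundedly_invertible_def)
    then show ?thesis
      by simp
  qed
  ultimately have "norm e \<le> fortin_norm G P * norm \<theta> + norm r"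
    by (cases "e = 0") auto
  then show ?thesis
    by (simp add: e_def r_def osc_def)
qed

theorem proposition3p2:
  fixes G :: "'x::{real_inner,complete_space} \<Rightarrow>\<^sub>L ('y::{real_inner,complete_space} \<Rightarrow>\<^sub>L real)"
    and f :: "'y \<Rightarrow>\<^sub>L real" and u :: 'x
    and D :: "'d set"
    and X Xhat :: "'d \<Rightarrow> 'x set" and Y :: "'d \<Rightarrow> 'y set"
    and P :: "'d \<Rightarrow> ('y \<Rightarrow>\<^sub>L 'y)"
    and c C :: real
    and \<theta> :: "'d \<Rightarrow> 'x" and l :: "'d \<Rightarrow> 'y" and ud :: "'d \<Rightarrow> 'x"
  assumes "boundedly_invertible G"
    and "blinfun_apply G u = f"
    and "\<And>\<delta>. \<delta> \<in> D \<Longrightarrow> subspace (X \<delta>) \<and> closed (X \<delta>) \<and> {0} \<subset> X \<delta> \<and> X \<delta> \<subset> UNIV"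
    and "\<And>\<delta>. \<delta> \<in> D \<Longrightarrow> subspace (Y \<delta>) \<and> closed (Y \<delta>) \<and> {0} \<subset> Y \<delta> \<and> Y \<delta> \<subset> UNIV"
    and "\<And>\<delta>. \<delta> \<in> D \<Longrightarrow> finite_dim_subspace (Xhat \<delta>) \<and> {0} \<subset> Xhat \<delta> \<and> Xhat \<delta> \<subset> UNIV"
    and "\<And>\<delta>. \<delta> \<in> D \<Longrightarrow> gamma_const G (X \<delta>) (Y \<delta>) > 0"
    and "\<And>\<delta>. \<delta> \<in> D \<Longrightarrow> mu_const G (Xhat \<delta>) (Y \<delta>) > 0"
    and "\<And>\<delta>. \<delta> \<in> D \<Longrightarrow> fortin_interpolator G (X \<delta>) (Y \<delta>) (P \<delta>)"
    and "0 < c" and "c \<le> C"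
    and "\<And>\<delta>. \<delta> \<in> D \<Longrightarrow>
           c / gamma_const G (X \<delta>) (Y \<delta>) \<le> fortin_norm G (P \<delta>) \<and>
           fortin_norm G (P \<delta>) \<le> C / gamma_const G (X \<delta>) (Y \<delta>)"
    and "\<And>\<delta>. \<delta> \<in> D \<Longrightarrow> saddle_solution G f (Xhat \<delta>) (Y \<delta>) (X \<delta>) (\<theta> \<delta>) (l \<delta>) (ud \<delta>)"
  shows "\<forall>\<delta>\<in>D.
           mu_const G (Xhat \<delta>) (Y \<delta>) * norm (\<theta> \<delta>) \<le> norm (u - ud \<delta>) \<and>
           norm (u - ud \<delta>) \<le> fortin_norm G (P \<delta>) * norm (\<theta> \<delta>) + osc G (P \<delta>) f"
proof (intro ballI conjI)
  fix \<delta> assume "\<delta> \<in> D"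
  note H = assms(5,7,8,12)[OF this]
  from H(4) have sol: "saddle_solution G (blinfun_apply G u) (Xhat \<delta>) (Y \<delta>) (X \<delta>) (\<theta> \<delta>) (l \<delta>) (ud \<delta>)"
    by (simp add: assms(2))
  show "mu_const G (Xhat \<delta>) (Y \<delta>) * norm (\<theta> \<delta>) \<le> norm (u - ud \<delta>)"
    using sol H by (intro saddle_lower_bound) auto
  show "norm (u - ud \<delta>) \<le> fortin_norm G (P \<delta>) * norm (\<theta> \<delta>) + osc G (P \<delta>) f"
    using saddle_upper_bound[OF assms(1) sol H(3)] by (simp add: assms(2))
qed

end
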